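(* Assume $\rho(\partial_0 f)<1$, and let $\tilde p$, $\tilde R$ and $D_a(0)$ be as defined in the context. Then $B(\tilde R)$ is included in the domain of attraction $D_a(0)$.
   Context: Let $\Omega\subset\mathbb{R}^n$ be a domain (open connected set) with $0\in\Omega$, and let $f:\Omega\to\Omega$ be an $\mathbb{R}$-analytic function with $f(0)=0$. Write $f^k$ for the $k$-th iterate of $f$ ($f^0=\mathrm{id}$), $\|\cdot\|$ for the Euclidean norm on $\mathbb{R}^n$ and for the induced operator norm on matrices, $A=\partial_0 f$ for the Jacobian matrix of $f$ at $0$, $\rho(A)$ for its spectral radius, and $B(r)=\{x\in\mathbb{R}^n:\|x\|<r\}$ for $r>0$. The domain of attraction of $0$ is $D_a(0)=\{x\in\Omega: f^k(x)\to 0 \text{ as } k\to\infty\}$. Standing assumption: $\rho(A)<1$. Let $\tilde p\geq 1$ be the smallest positive integer such that $\|A^p\|<1$ for any $p\geq\tilde p$. Let $\tilde R>0$ be the largest number such that $B(\tilde R)\subset\Omega$ and $\|f^p(x)\|<\|x\|$ for all $p\in\{\tilde p,\tilde p+1,\dots,2\tilde p-1\}$ and $x\in B(\tilde R)\setminus\{0\}$ (some positive radius with this property exists); if every $r>0$ has this property, then $\tilde R=+\infty$ and $B(\tilde R)=\Omega=\mathbb{R}^n$. *)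

theory Defs
  imports "HOL-Analysis.Analysis"
begin

text \<open>
  Real analyticity: near each point of \<open>S\<close>, \<open>f\<close> is the sum of a power series in several variables.
  Multi-indices are functions \<open>\<alpha>\<close> on the finite index type; unordered summation amounts to
  absolute convergence. Only values of \<open>f\<close> near \<open>S\<close> matter, so for open \<open>S\<close> this is
  analyticity of the restriction of \<open>f\<close> to \<open>S\<close>.
\<close>

definition real_analytic_on :: "(real^'n \<Rightarrow> real^'m) \<Rightarrow> (real^'n) set \<Rightarrow> bool" where
  "real_analytic_on f S \<longleftrightarrow>
     (\<forall>a\<in>S. \<exists>(c :: ('n \<Rightarrow> nat) \<Rightarrow> real^'m) r. 0 < r \<and>
        (\<forall>x\<in>ball a r.
           ((\<lambda>\<alpha>. (\<Prod>i\<in>UNIV. (x $ i - a $ i) ^ \<alpha> i) *\<^sub>R c \<alpha>) has_sum f x) UNIV))"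

text \<open>
  Non-real eigenvalues count as well, so the matrix is taken over the complex numbers.
\<close>

definition complex_eigenvalues :: "real^'n^'n \<Rightarrow> complex set" where
  "complex_eigenvalues A =
     {\<mu>. \<exists>v :: complex^'n. v \<noteq> 0 \<and> map_matrix complex_of_real A *v v = \<mu> *s v}"

definition matrix_spectral_radius :: "real^'n^'n \<Rightarrow> real" where
  "matrix_spectral_radius A = Max (norm ` complex_eigenvalues A)"

text \<open>
  The overloaded \<open>^\<close> and \<open>norm\<close> on type \<open>real^'n^'n\<close> are the componentwise power and the
  Frobenius norm, hence the next two definitions.
\<close>

definition matrix_power :: "real^'n^'n \<Rightarrow> nat \<Rightarrow> real^'n^'n" where
  "matrix_power A k = ((\<lambda>M. A ** M) ^^ k) (mat 1)"

definition matrix_opnorm :: "real^'n^'n \<Rightarrow> real" where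
  "matrix_opnorm A = onorm (\<lambda>x. A *v x)"

definition attraction_domain :: "(real^'n) set \<Rightarrow> (real^'n \<Rightarrow> real^'n) \<Rightarrow> (real^'n) set" where
  "attraction_domain \<Omega> f = {x \<in> \<Omega>. (\<lambda>k. (f ^^ k) x) \<longlonglongrightarrow> 0}"

definition p_tilde :: "(real^'n \<Rightarrow> real^'n) \<Rightarrow> nat" where
  "p_tilde f =
     (LEAST p. 1 \<le> p \<and> (\<forall>q\<ge>p. matrix_opnorm (matrix_power (jacobian f (at 0)) q) < 1))"

text \<open>
  The radius ranges over the extended reals, and \<open>eball 0 \<infinity> = UNIV\<close>. So \<open>\<infinity>\<close> is admissible
  exactly when every positive real radius is, and then it is the greatest admissible one.
\<close>

definition admissible_radius ::
  "(real^'n) set \<Rightarrow> (real^'n \<Rightarrow> real^'n) \<Rightarrow> ereal \<Rightarrow> bool" where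
  "admissible_radius \<Omega> f r \<longleftrightarrow>
     0 < r \<and> eball 0 r \<subseteq> \<Omega> \<and>
     (\<forall>p \<in> {p_tilde f .. 2 * p_tilde f - 1}. \<forall>x \<in> eball 0 r - {0}. norm ((f ^^ p) x) < norm x)"

definition R_tilde :: "(real^'n) set \<Rightarrow> (real^'n \<Rightarrow> real^'n) \<Rightarrow> ereal" where
  "R_tilde \<Omega> f = (GREATEST r. admissible_radius \<Omega> f r)"

end

theory Submission
  imports Defs "HOL-Computational_Algebra.Fundamental_Theorem_Algebra"
begin

text \<open>
  Write \<open>A\<close> for the Jacobian of \<open>f\<close> at \<open>0\<close>, \<open>p\<close> for \<open>p_tilde f\<close> and \<open>R\<close> for \<open>R_tilde \<Omega> f\<close>. The attraction
  itself is a compactness argument. Suppose that \<open>g = f ^^ p\<close> strictly decreases the norm of every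
  nonzero point of the ball of radius \<open>R\<close>. Along an orbit of \<open>g\<close> the norms then decrease to some
  \<open>L\<close>; by compactness the orbit has a cluster point \<open>y\<close>, and continuity gives
  \<open>norm y = L = norm (g y)\<close>, which forces \<open>y = 0\<close> and \<open>L = 0\<close>
  (\<open>iterates_tendsto_0_if_norm_decreasing\<close>). The orbit of \<open>f\<close> splits into \<open>p\<close> subsequences
  \<open>(f ^^ i) ((g ^^ j) x)\<close> with \<open>i < p\<close>, each of which tends to \<open>(f ^^ i) 0 = 0\<close>.

  The longer part of the proof shows that \<open>p_tilde f\<close> and \<open>R_tilde \<Omega> f\<close>, which are defined by
  choice operators for a least and a greatest element, have the property that defines them.

  \<^item> For \<open>p_tilde f\<close> the operator norms of the powers of \<open>A\<close> must tend to \<open>0\<close>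
    (\<open>matrix_opnorm_power_tendsto_0\<close>). Some nonzero complex polynomial annihilates \<open>A\<close>. Its linear
    factors are stripped off one at a time: a factor whose root is no eigenvalue is injective and
    can be dropped, and a factor with root \<open>\<mu>\<close> of modulus less than \<open>1\<close> leads to a scalar
    recursion \<open>u (k + 1) = \<mu> * u k + w k\<close> with \<open>w\<close> tending to \<open>0\<close>. The same polynomial shows
    that there are only finitely many eigenvalues, so that the maximum that defines the spectral
    radius bounds each of them.

  \<^item> For \<open>R_tilde \<Omega> f\<close>, a union of balls of admissible radii is again such a ball, so it
    suffices to find one admissible radius (\<open>admissible_radius_R_tilde\<close>). The chain rule makes
    \<open>A\<close> to the power \<open>q\<close> the derivative of \<open>f ^^ q\<close> at \<open>0\<close>, and for \<open>q \<ge> p\<close> its operator norm is less than \<open>1\<close>;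
    hence \<open>f ^^ q\<close> decreases the norm near \<open>0\<close>. The chain rule needs \<open>f\<close> to be differentiable,
    which follows from absolute convergence of the power series: the terms of degree at least \<open>2\<close>
    are bounded by a multiple of the squared norm (\<open>real_analytic_on_imp_differentiable\<close>).
\<close>

section \<open>Polynomials in a matrix\<close>

lemma mat_matrix_mult_component:
  "(mat a ** M) $ i $ j = a * M $ i $ j" for a :: "'a::comm_semiring_1"
proof -
  have "(mat a ** M) $ i $ j = (\<Sum>k\<in>UNIV. if k = i then a * M $ k $ j else 0)"
    unfolding matrix_matrix_mult_def mat_def vec_lambda_beta by (rule sum.cong) auto
  then show ?thesis by simp
qed

lemma mat_mult_vec: "mat a *v v = a *s v" for a :: "'a::comm_semiring_1"
proof -
  have "(mat a *v v) $ i = (\<Sum>k\<in>UNIV. if k = i then a * v $ k else 0)" for i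
    unfolding matrix_vector_mult_def mat_def vec_lambda_beta by (rule sum.cong) auto
  then show ?thesis by (simp add: vec_eq_iff)
qed

lemma matrix_mult_mat_commute: "M ** mat a = mat a ** M" for a :: "'a::comm_semiring_1"
proof -
  have "(M ** mat a) $ i $ j = (\<Sum>k\<in>UNIV. if k = j then M $ i $ k * a else 0)" for i j
    unfolding matrix_matrix_mult_def mat_def vec_lambda_beta by (rule sum.cong) auto
  then show ?thesis by (simp add: vec_eq_iff mat_matrix_mult_component mult.commute)
qed

text \<open>
  Evaluation of a polynomial at a matrix, by Horner's rule.
\<close>

definition matrix_poly :: "'a::comm_ring_1 poly \<Rightarrow> 'a^'n^'n \<Rightarrow> 'a^'n^'n" where
  "matrix_poly p B = fold_coeffs (\<lambda>a M. mat a + B ** M) p 0"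

lemma matrix_poly_0 [simp]: "matrix_poly 0 B = 0"
  by (simp add: matrix_poly_def)

lemma matrix_poly_pCons [simp]: "matrix_poly (pCons a p) B = mat a + B ** matrix_poly p B"
  by (cases "p = 0"; cases "a = 0") (simp_all add: matrix_poly_def)

lemma matrix_poly_add: "matrix_poly (p + q) B = matrix_poly p B + matrix_poly q B"
proof -
  have mat_add: "mat (a + b) = (mat a + mat b :: 'a^'n^'n)" for a b :: 'a
    by (simp add: mat_def vec_eq_iff)
  show ?thesis
    by (induction p q rule: poly_induct2) (simp_all add: mat_add matrix_add_ldistrib)
qed

lemma matrix_poly_smult: "matrix_poly (smult a p) B = mat a ** matrix_poly p B"
proof -
  have mat_mult: "mat (a * b) = (mat a ** mat b :: 'a^'n^'n)" for b
    by (simp add: vec_eq_iff mat_matrix_mult_component) (simp add: mat_def)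
  have commute: "B ** (mat a ** X) = mat a ** (B ** X)" for X
    by (simp add: matrix_mul_assoc matrix_mult_mat_commute[of B])
  show ?thesis
    by (induction p) (simp_all add: mat_mult matrix_add_ldistrib commute)
qed

lemma matrix_add_rdistrib: "(A + B) ** C = A ** C + B ** C"
  for A B :: "'a::semiring_1^'n^'m"
  by (simp add: matrix_matrix_mult_def vec_eq_iff sum.distrib distrib_right)

lemma matrix_poly_mult: "matrix_poly (p * q) B = matrix_poly p B ** matrix_poly q B"
  by (induction p)
    (simp_all add: mult_pCons_left matrix_poly_add matrix_poly_smult matrix_add_rdistrib
      matrix_mul_assoc)

text \<open>
  The space of \<open>n \<times> n\<close> matrices has finite dimension, so the powers of \<open>B\<close> cannot be independent:
  some power is a combination of the lower ones. Spans are over the reals, where the matrix space is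
  a Euclidean space; this does no harm, since real coefficients are complex ones.
\<close>

lemma exists_annihilating_poly:
  fixes B :: "complex^'n^'n"
  obtains p where "p \<noteq> 0" "matrix_poly p B = 0"
proof -
  define P where "P k = matrix_poly (monom 1 k) B" for k
  have "\<exists>d. P d \<in> span (P ` {..<d})"
  proof (rule ccontr)
    assume *: "\<nexists>d. P d \<in> span (P ` {..<d})"
    have "independent (P ` {..<d}) \<and> card (P ` {..<d}) = d" for d
    proof (induction d)
      case (Suc d)
      then show ?case using * span_base[of "P d" "P ` {..<d}"]
        by (auto simp: lessThan_Suc independent_insert)
    qed (simp add: independent_empty)
    then show False
      using independent_bound[of "P ` {..<Suc (DIM(complex^'n^'n))}"] by simp
  qed
  then obtain d where d: "P d \<in> span (P ` {..<d})" by blast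
  \<comment> \<open>The values at \<open>B\<close> of the polynomials of degree less than \<open>d\<close>; the condition on the coefficients
      also admits \<open>d = 0\<close>.\<close>
  define S where "S = {matrix_poly q B | q. \<forall>k\<ge>d. coeff q k = 0}"
  have "subspace S"
    unfolding subspace_def
  proof (intro conjI ballI allI)
    show "0 \<in> S" by (auto simp: S_def intro!: exI[of _ 0])
  next
    fix x y assume "x \<in> S" "y \<in> S"
    then obtain q r where "x = matrix_poly q B" "\<forall>k\<ge>d. coeff q k = 0"
      "y = matrix_poly r B" "\<forall>k\<ge>d. coeff r k = 0" by (auto simp: S_def)
    then show "x + y \<in> S" by (auto simp: S_def matrix_poly_add intro!: exI[of _ "q + r"])
  next
    fix c :: real and x assume "x \<in> S"
    then obtain q where q: "x = matrix_poly q B" "\<forall>k\<ge>d. coeff q k = 0" by (auto simp: S_def)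
    have "c *\<^sub>R x = matrix_poly (smult (complex_of_real c) q) B"
      by (simp add: q matrix_poly_smult vec_eq_iff mat_matrix_mult_component)
        (simp add: scaleR_conv_of_real)
    then show "c *\<^sub>R x \<in> S" using q by (auto simp: S_def intro!: exI[of _ "smult (complex_of_real c) q"])
  qed
  moreover have "P ` {..<d} \<subseteq> S"
    by (auto simp: S_def P_def intro!: exI[of _ "monom 1 _"])
  ultimately have "P d \<in> S" using d span_minimal by blast
  then obtain q where q: "matrix_poly q B = P d" "coeff q d = 0" by (auto simp: S_def)
  have "matrix_poly (monom 1 d + smult (-1) q) B = 0"
    unfolding matrix_poly_add matrix_poly_smult q(1) P_def
    by (simp add: vec_eq_iff mat_matrix_mult_component)
  moreover have "coeff (monom 1 d + smult (-1) q) d = 1" using q by simp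
  ultimately show thesis using that by (metis coeff_0 zero_neq_one)
qed

lemma matrix_poly_eigenvector:
  fixes B :: "'a::field^'n^'n"
  assumes "B *v v = \<mu> *s v"
  shows "matrix_poly p B *v v = poly p \<mu> *s v"
proof (induction p)
  case (pCons a p)
  have "B *v (poly p \<mu> *s v) = poly p \<mu> *s (\<mu> *s v)"
    by (simp only: vector_scalar_commute assms)
  then show ?case using pCons
    by (simp add: matrix_vector_mult_add_rdistrib mat_mult_vec vector_smult_assoc vector_sadd_rdistrib mult.commute
      flip: matrix_vector_mul_assoc)
qed simp

text \<open>
  Every eigenvalue is a root of an annihilating polynomial.
\<close>

lemma finite_eigenvalues: "finite (complex_eigenvalues A)"
proof -
  let ?B = "map_matrix complex_of_real A"
  obtain p where p: "p \<noteq> 0" "matrix_poly p ?B = 0" by (rule exists_annihilating_poly)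
  have "complex_eigenvalues A \<subseteq> {z. poly p z = 0}"
    using matrix_poly_eigenvector[of ?B _ _ p] p by (fastforce simp: complex_eigenvalues_def)
  then show ?thesis using poly_roots_finite[OF p(1)] finite_subset by blast
qed

section \<open>Powers of a matrix of spectral radius less than one\<close>

lemma linear_recurrence_tendsto_0:
  fixes u w :: "nat \<Rightarrow> complex"
  assumes rec: "\<And>k. u (Suc k) = \<mu> * u k + w k"
    and \<mu>: "norm \<mu> < 1" and w: "w \<longlonglongrightarrow> 0"
  shows "u \<longlonglongrightarrow> 0"
proof (rule LIMSEQ_I)
  (* Once |w k| is at most e / 2 * (1 - |mu|), the value e / 2 is a fixed point of the majorizing
     recursion, so beyond it only a geometrically decaying part remains. *)
  fix e :: real assume "e > 0"
  have "e / 2 * (1 - norm \<mu>) > 0" using \<open>e > 0\<close> \<mu> by simp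
  then obtain N where N: "\<And>k. k \<ge> N \<Longrightarrow> norm (w k) < e / 2 * (1 - norm \<mu>)"
    using LIMSEQ_D[OF w] by fastforce
  have bound: "norm (u (N + j)) \<le> norm \<mu> ^ j * norm (u N) + e / 2" for j
  proof (induction j)
    case 0
    then show ?case using \<open>e > 0\<close> by simp
  next
    case (Suc j)
    have "norm (u (N + Suc j)) \<le> norm \<mu> * norm (u (N + j)) + norm (w (N + j))"
      by (metis rec add_Suc_right norm_mult norm_triangle_ineq)
    also have "\<dots> \<le> norm \<mu> * (norm \<mu> ^ j * norm (u N) + e / 2) + e / 2 * (1 - norm \<mu>)"
      using Suc N[of "N + j"] by (intro add_mono mult_left_mono) auto
    also have "\<dots> = norm \<mu> ^ Suc j * norm (u N) + e / 2"
      by (simp add: field_simps)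
    finally show ?case .
  qed
  have "(\<lambda>j. norm \<mu> ^ j * norm (u N)) \<longlonglongrightarrow> 0 * norm (u N)"
    using \<mu> by (intro tendsto_mult LIMSEQ_power_zero tendsto_const) auto
  then have "eventually (\<lambda>j. norm \<mu> ^ j * norm (u N) < e / 2) sequentially"
    using \<open>e > 0\<close> by (intro order_tendstoD) auto
  then obtain J where J: "\<And>j. j \<ge> J \<Longrightarrow> norm \<mu> ^ j * norm (u N) < e / 2"
    by (auto simp: eventually_sequentially)
  have "norm (u k - 0) < e" if "k \<ge> N + J" for k
  proof -
    have "N + (k - N) = k" "k - N \<ge> J" using that by auto
    then show ?thesis using bound[of "k - N"] J[of "k - N"] by simp
  qed
  then show "\<exists>n0. \<forall>k\<ge>n0. norm (u k - 0) < e" by blast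
qed

text \<open>
  Induction on the degree strips off one linear factor of \<open>p\<close>. If its root \<open>\<mu>\<close> has modulus less than
  \<open>1\<close>, the quotient annihilates \<open>w = B *v v - \<mu> *s v\<close>, and the iterates of \<open>v\<close> satisfy a
  linear recurrence with perturbation the iterates of \<open>w\<close>. Otherwise \<open>\<mu>\<close> is not an eigenvalue, and
  the quotient already annihilates \<open>v\<close>.
\<close>

lemma iterates_tendsto_0_if_annihilated:
  fixes B :: "complex^'n^'n"
  assumes eig: "\<And>\<mu> v. v \<noteq> 0 \<Longrightarrow> B *v v = \<mu> *s v \<Longrightarrow> norm \<mu> < 1"
    and "p \<noteq> 0" and "matrix_poly p B *v v = 0"
  shows "(\<lambda>k. (((*v) B) ^^ k) v) \<longlonglongrightarrow> 0"
  using assms(2,3)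
proof (induction "degree p" arbitrary: p v)
  case 0
  then obtain a where "p = [:a:]" "a \<noteq> 0" by (metis degree_eq_zeroE pCons_0_0)
  then have "v = 0" using 0 by (simp add: mat_mult_vec)
  moreover have "(((*v) B) ^^ k) 0 = 0" for k by (induction k) auto
  ultimately show ?case by simp
next
  case (Suc d)
  obtain \<mu> where "poly p \<mu> = 0"
    using Suc.hyps(2) fundamental_theorem_of_algebra constant_degree by (metis nat.simps(3))
  then obtain q where q: "p = [:-\<mu>, 1:] * q" by (auto simp: poly_eq_0_iff_dvd dvd_def)
  then have "q \<noteq> 0" using Suc.prems by auto
  then have deg: "d = degree q" using Suc.hyps(2) by (simp add: q degree_mult_eq del: mult_pCons_left)
  define w where "w = B *v v - \<mu> *s v"
  have lin: "matrix_poly [:-\<mu>, 1:] B *v u = B *v u - \<mu> *s u" for u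
    by (simp add: matrix_vector_mult_add_rdistrib mat_mult_vec)
  show ?case
  proof (cases "norm \<mu> < 1")
    case True
    have "matrix_poly p B = matrix_poly q B ** matrix_poly [:-\<mu>, 1:] B"
      by (metis q mult.commute matrix_poly_mult)
    then have "matrix_poly q B *v w = matrix_poly p B *v v"
      unfolding w_def lin[symmetric] matrix_vector_mul_assoc by simp
    then have w0: "(\<lambda>k. (((*v) B) ^^ k) w) \<longlonglongrightarrow> 0"
      using Suc.hyps(1)[OF deg \<open>q \<noteq> 0\<close>] Suc.prems by simp
    have rec: "(((*v) B) ^^ Suc k) v = \<mu> *s (((*v) B) ^^ k) v + (((*v) B) ^^ k) w" for k
    proof (induction k)
      case (Suc k)
      then show ?case
        by (simp add: matrix_vector_right_distrib vector_scalar_commute)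
    qed (simp add: w_def)
    show ?thesis
    proof (rule vec_tendstoI)
      fix i
      show "(\<lambda>k. (((*v) B) ^^ k) v $ i) \<longlonglongrightarrow> 0 $ i"
        using linear_recurrence_tendsto_0[of "\<lambda>k. (((*v) B) ^^ k) v $ i" \<mu> "\<lambda>k. (((*v) B) ^^ k) w $ i"]
          tendsto_vec_nth[OF w0, of i] rec True by simp
    qed
  next
    case False
    have "B *v (matrix_poly q B *v v) = \<mu> *s (matrix_poly q B *v v)"
      using Suc.prems lin[of "matrix_poly q B *v v"]
      by (simp add: q matrix_poly_mult del: matrix_poly_pCons mult_pCons_left flip: matrix_vector_mul_assoc)
    then have "matrix_poly q B *v v = 0" using eig False by blast
    then show ?thesis using Suc.hyps(1)[OF deg \<open>q \<noteq> 0\<close>] by blast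
  qed
qed

lemma matrix_power_mult_vec: "matrix_power A k *v x = (((*v) A) ^^ k) x"
  unfolding matrix_power_def
  by (induction k) (auto simp flip: matrix_vector_mul_assoc)

lemma matrix_opnorm_power_tendsto_0:
  fixes A :: "real^'n^'n"
  assumes "matrix_spectral_radius A < 1"
  shows "(\<lambda>k. matrix_opnorm (matrix_power A k)) \<longlonglongrightarrow> 0"
proof -
  define B where "B = map_matrix complex_of_real A"
  have eig: "norm \<mu> < 1" if "v \<noteq> 0" "B *v v = \<mu> *s v" for \<mu> v
  proof -
    have "\<mu> \<in> complex_eigenvalues A" using that by (auto simp: complex_eigenvalues_def B_def)
    then have "norm \<mu> \<le> matrix_spectral_radius A"
      unfolding matrix_spectral_radius_def by (intro Max_ge) (auto simp: finite_eigenvalues)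
    then show ?thesis using assms by simp
  qed
  obtain p where p: "p \<noteq> 0" "matrix_poly p B = 0" by (rule exists_annihilating_poly)
  define c :: "real^'n \<Rightarrow> complex^'n" where "c x = (\<chi> i. complex_of_real (x $ i))" for x
  have "c (A *v x) = B *v c x" for x
    by (simp add: c_def B_def vec_eq_iff matrix_vector_mult_def)
  then have c: "c ((((*v) A) ^^ k) x) = (((*v) B) ^^ k) (c x)" for k x
    by (induction k) auto
  have entry: "(\<lambda>k. matrix_power A k $ i $ j) \<longlonglongrightarrow> 0" for i j
  proof -
    have "(\<lambda>k. (((*v) B) ^^ k) (c (axis j 1)) $ i) \<longlonglongrightarrow> 0 $ i"
      using p by (intro tendsto_vec_nth iterates_tendsto_0_if_annihilated[of B p] eig) auto
    then have "(\<lambda>k. complex_of_real ((matrix_power A k *v axis j 1) $ i)) \<longlonglongrightarrow> 0"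
      by (simp add: matrix_power_mult_vec flip: c) (simp add: c_def)
    then have "(\<lambda>k. (matrix_power A k *v axis j 1) $ i) \<longlonglongrightarrow> 0"
      using tendsto_of_real_iff[where 'a=complex and c=0] by force
    then show ?thesis by (simp add: matrix_vector_mult_basis column_def)
  qed
  have "(\<lambda>k. \<Sum>i\<in>UNIV. \<Sum>j\<in>UNIV. \<bar>matrix_power A k $ i $ j\<bar>) \<longlonglongrightarrow> 0"
    using entry by (intro tendsto_null_sum tendsto_rabs_zero)
  then show ?thesis
  proof (rule Lim_null_comparison[rotated])
    show "\<forall>\<^sub>F k in sequentially. norm (matrix_opnorm (matrix_power A k))
        \<le> (\<Sum>i\<in>UNIV. \<Sum>j\<in>UNIV. \<bar>matrix_power A k $ i $ j\<bar>)"
      by (simp add: matrix_opnorm_def onorm_le_matrix_component_sum onorm_pos_le matrix_vector_mul_bounded_linear)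
  qed
qed

text \<open>
  The least element exists because the operator norms of the powers tend to \<open>0\<close>.
\<close>

lemma p_tilde_works:
  assumes "matrix_spectral_radius (jacobian f (at 0)) < 1"
  shows "1 \<le> p_tilde f"
    and "q \<ge> p_tilde f \<Longrightarrow> matrix_opnorm (matrix_power (jacobian f (at 0)) q) < 1"
proof -
  let ?A = "jacobian f (at 0)"
  have "\<forall>\<^sub>F q in sequentially. matrix_opnorm (matrix_power ?A q) < 1"
    using matrix_opnorm_power_tendsto_0[OF assms] by (rule order_tendstoD) simp
  then obtain N where "\<forall>q\<ge>N. matrix_opnorm (matrix_power ?A q) < 1"
    by (auto simp: eventually_sequentially)
  then have "1 \<le> max 1 N \<and> (\<forall>q\<ge>max 1 N. matrix_opnorm (matrix_power ?A q) < 1)" by simp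
  from LeastI[of "\<lambda>p. 1 \<le> p \<and> (\<forall>q\<ge>p. matrix_opnorm (matrix_power ?A q) < 1)", OF this]
  show "1 \<le> p_tilde f" "q \<ge> p_tilde f \<Longrightarrow> matrix_opnorm (matrix_power ?A q) < 1"
    unfolding p_tilde_def[symmetric] by blast+
qed


section \<open>Real analytic functions are differentiable\<close>

text \<open>
  Unordered convergence of real families is absolute; in finite dimension this can be applied to
  each coordinate.
\<close>

lemma summable_on_imp_norm_summable_on_cart:
  fixes f :: "'a \<Rightarrow> real^'m"
  assumes "f summable_on A"
  shows "(\<lambda>x. norm (f x)) summable_on A"
proof -
  have component: "(\<lambda>x. \<bar>f x $ i\<bar>) summable_on A" for i
    using iffD1[OF summable_on_iff_abs_summable_on_real
        summable_on_bounded_linear[OF bounded_linear_vec_nth[of i] assms]]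
    by simp
  have "(\<lambda>x. \<Sum>i\<in>I. \<bar>f x $ i\<bar>) summable_on A" if "finite I" for I :: "'m set"
    using that by (induction I rule: finite_induct) (auto intro: summable_on_add component)
  then show ?thesis
    by (rule Infinite_Sum.abs_summable_on_comparison_test') (auto intro: norm_le_l1_cart)
qed

definition monomial_at :: "real^'n \<Rightarrow> ('n \<Rightarrow> nat) \<Rightarrow> real" where
  "monomial_at h \<alpha> = (\<Prod>i\<in>UNIV. (h $ i) ^ \<alpha> i)"

text \<open>
  Each coordinate of \<open>h\<close> is at most \<open>norm h\<close>. Of the resulting powers of \<open>norm h / t \<le> 1\<close> two
  are kept, and \<open>t\<close> to the degree is the value of the monomial where all coordinates equal \<open>t\<close>.
\<close>

lemma monomial_at_bound:
  assumes "0 < t" and "norm h \<le> t" and deg: "2 \<le> (\<Sum>i\<in>UNIV. \<alpha> i)"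
  shows "\<bar>monomial_at h \<alpha>\<bar> \<le> (norm h / t)\<^sup>2 * t ^ (\<Sum>i\<in>UNIV. \<alpha> i)"
proof -
  have "\<bar>monomial_at h \<alpha>\<bar> \<le> (\<Prod>i\<in>UNIV. norm h ^ \<alpha> i)"
    unfolding monomial_at_def abs_prod power_abs
    by (intro prod_mono conjI power_mono component_le_norm_cart) auto
  also have "\<dots> = (norm h / t) ^ (\<Sum>i\<in>UNIV. \<alpha> i) * t ^ (\<Sum>i\<in>UNIV. \<alpha> i)"
    using \<open>0 < t\<close> by (simp add: power_sum power_divide prod_dividef)
  also have "\<dots> \<le> (norm h / t)\<^sup>2 * t ^ (\<Sum>i\<in>UNIV. \<alpha> i)"
    using assms by (intro mult_right_mono power_decreasing) auto
  finally show ?thesis .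
qed

lemma multi_index_degree_le_1:
  fixes \<alpha> :: "'n::finite \<Rightarrow> nat"
  assumes "(\<Sum>i\<in>UNIV. \<alpha> i) < 2"
  shows "\<alpha> = (\<lambda>_. 0) \<or> (\<exists>i. \<alpha> = (\<lambda>j. if j = i then 1 else 0))"
proof (cases "\<exists>i. \<alpha> i \<noteq> 0")
  case True
  then obtain i where i: "\<alpha> i \<noteq> 0" by blast
  have "(\<Sum>i\<in>UNIV. \<alpha> i) = \<alpha> i + (\<Sum>j\<in>UNIV - {i}. \<alpha> j)" by (simp add: sum.remove)
  with i assms have "\<alpha> i = 1" "(\<Sum>j\<in>UNIV - {i}. \<alpha> j) = 0" by linarith+
  then have "\<alpha> = (\<lambda>j. if j = i then 1 else 0)" by (auto simp: fun_eq_iff)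
  then show ?thesis by blast
qed (auto simp: fun_eq_iff)

text \<open>
  The terms of degree \<open>0\<close> and \<open>1\<close> form the affine approximation. By the preceding bound on monomials,
  each remaining term is at most \<open>(norm h / t)\<^sup>2\<close> times the corresponding term of the
  absolutely convergent series at the point whose coordinates all equal \<open>t\<close>. So the remainder is
  quadratically small.
\<close>

lemma real_analytic_on_imp_differentiable:
  fixes f :: "real^'n \<Rightarrow> real^'m"
  assumes "real_analytic_on f S" and "a \<in> S"
  shows "f differentiable (at a)"
proof -
  obtain c :: "('n \<Rightarrow> nat) \<Rightarrow> real^'m" and r where "0 < r"
    and f: "\<And>x. x \<in> ball a r \<Longrightarrow>
      ((\<lambda>\<alpha>. (\<Prod>i\<in>UNIV. (x $ i - a $ i) ^ \<alpha> i) *\<^sub>R c \<alpha>) has_sum f x) UNIV"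
    using assms unfolding real_analytic_on_def by blast
  have f: "((\<lambda>\<alpha>. monomial_at h \<alpha> *\<^sub>R c \<alpha>) has_sum f (a + h)) UNIV" if "norm h < r" for h
    using f[of "a + h"] that by (simp add: monomial_at_def dist_norm)
  define e :: "'n \<Rightarrow> 'n \<Rightarrow> nat" where "e i = (\<lambda>j. if j = i then 1 else 0)" for i
  define F where "F = insert (\<lambda>_. 0) (range e)"
  have "finite F" by (simp add: F_def)
  have mono0: "monomial_at h (\<lambda>_. 0) = 1" for h :: "real^'n"
    by (simp add: monomial_at_def)
  have mono1: "monomial_at h (e i) = h $ i" for h :: "real^'n" and i
  proof -
    have "monomial_at h (e i) = (\<Prod>j\<in>UNIV. if j = i then h $ j else 1)"
      unfolding monomial_at_def e_def by (rule prod.cong) auto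
    then show ?thesis by simp
  qed
  have "inj e" by (rule injI) (metis e_def zero_neq_one)
  have "(\<lambda>_. 0) \<notin> range e" by (metis e_def rangeE zero_neq_one)
  have degree_F: "2 \<le> (\<Sum>i\<in>UNIV. \<alpha> i)" if "\<alpha> \<notin> F" for \<alpha>
    using multi_index_degree_le_1[of \<alpha>] that by (force simp: F_def e_def)
  define L where "L h = (\<Sum>i\<in>UNIV. h $ i *\<^sub>R c (e i))" for h :: "real^'n"
  have sumF: "(\<Sum>\<alpha>\<in>F. monomial_at h \<alpha> *\<^sub>R c \<alpha>) = c (\<lambda>_. 0) + L h" for h
    using \<open>(\<lambda>_. 0) \<notin> range e\<close> by (simp add: F_def L_def mono0 mono1 sum.reindex[OF \<open>inj e\<close>])
  have tail: "((\<lambda>\<alpha>. monomial_at h \<alpha> *\<^sub>R c \<alpha>) has_sum (f (a + h) - (c (\<lambda>_. 0) + L h))) (UNIV - F)"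
    if "norm h < r" for h
    using has_sum_Diff[OF f[OF that] has_sum_finite[OF \<open>finite F\<close>]] by (simp add: sumF)
  \<comment> \<open>The factor \<open>1 / 2\<close> puts the point with all coordinates \<open>t\<close> strictly inside the ball of convergence.\<close>
  define N where "N = norm (\<chi> i. 1 :: real^'n)"
  have "N > 0" by (simp add: N_def vec_eq_iff)
  define t where "t = r / (2 * N)"
  have "t > 0" using \<open>0 < r\<close> \<open>N > 0\<close> by (simp add: t_def)
  have diag: "(\<chi> i. t :: real^'n) = t *\<^sub>R (\<chi> i. 1)" by (simp add: vec_eq_iff)
  have "norm (\<chi> i. t :: real^'n) < r"
    unfolding diag using \<open>0 < r\<close> \<open>N > 0\<close> by (simp add: N_def[symmetric] t_def)
  then have "(\<lambda>\<alpha>. monomial_at (\<chi> i. t) \<alpha> *\<^sub>R c \<alpha>) summable_on UNIV"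
    using f has_sum_imp_summable by blast
  then have "(\<lambda>\<alpha>. norm (monomial_at (\<chi> i. t) \<alpha> *\<^sub>R c \<alpha>)) summable_on (UNIV - F)"
    by (intro summable_on_subset_banach[OF summable_on_imp_norm_summable_on_cart]) auto
  then have summ: "(\<lambda>\<alpha>. t ^ (\<Sum>i\<in>UNIV. \<alpha> i) * norm (c \<alpha>)) summable_on (UNIV - F)"
    using \<open>t > 0\<close> by (simp add: monomial_at_def flip: power_sum)
  define K where "K = (\<Sum>\<^sub>\<infinity>\<alpha>\<in>UNIV - F. t ^ (\<Sum>i\<in>UNIV. \<alpha> i) * norm (c \<alpha>))"
  have tail_bound: "norm (f (a + h) - (c (\<lambda>_. 0) + L h)) \<le> (norm h / t)\<^sup>2 * K"
    if h: "norm h < r" "norm h \<le> t" for h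
  proof -
    have bound: "norm (monomial_at h \<alpha> *\<^sub>R c \<alpha>)
        \<le> (norm h / t)\<^sup>2 * (t ^ (\<Sum>i\<in>UNIV. \<alpha> i) * norm (c \<alpha>))" if "\<alpha> \<in> UNIV - F" for \<alpha>
      using mult_right_mono[OF monomial_at_bound[OF \<open>t > 0\<close> h(2) degree_F], of \<alpha> "norm (c \<alpha>)"] that
      by (simp add: mult.assoc)
    have major: "((\<lambda>\<alpha>. (norm h / t)\<^sup>2 * (t ^ (\<Sum>i\<in>UNIV. \<alpha> i) * norm (c \<alpha>)))
        has_sum (norm h / t)\<^sup>2 * K) (UNIV - F)"
      unfolding K_def by (intro has_sum_cmult_right has_sum_infsum summ)
    have "(\<lambda>\<alpha>. norm (monomial_at h \<alpha> *\<^sub>R c \<alpha>)) summable_on (UNIV - F)"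
      using has_sum_imp_summable[OF major] bound by (rule Infinite_Sum.abs_summable_on_comparison_test')
    then obtain n where n: "((\<lambda>\<alpha>. norm (monomial_at h \<alpha> *\<^sub>R c \<alpha>)) has_sum n) (UNIV - F)"
      by (auto simp: summable_on_def)
    have "norm (f (a + h) - (c (\<lambda>_. 0) + L h)) \<le> n"
      using n tail[OF h(1)] by (rule norm_has_sum_bound)
    also have "n \<le> (norm h / t)\<^sup>2 * K" using n major bound by (rule has_sum_mono)
    finally show ?thesis .
  qed
  have L0: "L 0 = 0" by (simp add: L_def)
  have fa: "f a = c (\<lambda>_. 0)" using tail_bound[of 0] \<open>0 < r\<close> \<open>t > 0\<close> by (simp add: L0)
  have "bounded_linear L"
    unfolding L_def
    by (intro bounded_linear_sum bounded_linear_compose[OF bounded_linear_scaleR_left] bounded_linear_vec_nth)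
  moreover have "(\<lambda>h. norm (f (a + h) - f a - L h) / norm h) \<midarrow>0\<rightarrow> 0"
  proof (rule Lim_null_comparison)
    show "\<forall>\<^sub>F h in at 0. norm (norm (f (a + h) - f a - L h) / norm h) \<le> norm h * (K / t\<^sup>2)"
      unfolding eventually_at
    proof (intro exI[of _ "min r t"] conjI ballI impI)
      show "0 < min r t" using \<open>0 < r\<close> \<open>t > 0\<close> by simp
      fix h :: "real^'n" assume "h \<noteq> 0 \<and> dist h 0 < min r t"
      then show "norm (norm (f (a + h) - f a - L h) / norm h) \<le> norm h * (K / t\<^sup>2)"
        using tail_bound[of h] by (simp add: fa field_simps power2_eq_square)
    qed
    show "(\<lambda>h :: real^'n. norm h * (K / t\<^sup>2)) \<midarrow>0\<rightarrow> 0"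
      by (intro tendsto_mult_left_zero tendsto_norm_zero tendsto_ident_at)
  qed
  ultimately show ?thesis unfolding differentiable_def has_derivative_at by blast
qed

section \<open>The radius is attained\<close>

lemma funpow_has_derivative_at_fixpoint:
  assumes "(f has_derivative D) (at a)" and "f a = a"
  shows "(f ^^ k has_derivative D ^^ k) (at a)"
proof (induction k)
  case (Suc k)
  have "(f ^^ k) a = a" using assms(2) by (induction k) auto
  then show ?case using diff_chain_at[OF Suc, of f D] assms(1) by (simp add: o_def)
qed (simp add: id_def)

lemma eventually_norm_less_if_onorm_less_1:
  assumes "(g has_derivative D) (at 0)" and "g 0 = 0" and "onorm D < 1"
  shows "\<forall>\<^sub>F x in at 0. norm (g x) < norm x"
proof -
  interpret D: bounded_linear D using assms(1) by (rule has_derivative_bounded_linear)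
  have "(\<lambda>h. norm (g h - D h) / norm h) \<midarrow>0\<rightarrow> 0"
    using assms by (simp add: has_derivative_at)
  then have "\<forall>\<^sub>F h in at 0. norm (g h - D h) / norm h < 1 - onorm D"
    using assms(3) by (intro order_tendstoD) auto
  moreover have "\<forall>\<^sub>F h in at 0. h \<noteq> (0::'a)" by (rule eventually_neq_at_within)
  ultimately show ?thesis
  proof eventually_elim
    case (elim h)
    have "norm (g h) \<le> norm (g h - D h) + norm (D h)"
      by (metis diff_add_cancel norm_triangle_ineq)
    also have "\<dots> < (1 - onorm D) * norm h + onorm D * norm h"
      using elim onorm[OF D.bounded_linear_axioms, of h]
      by (intro add_less_le_mono) (auto simp: pos_divide_less_eq)
    finally show ?case by (simp add: algebra_simps)
  qed
qed

text \<open>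
  Differentiability at \<open>0\<close> gives one admissible radius: each of the finitely many iterates involved has
  derivative of operator norm less than \<open>1\<close>. Then the supremum of all admissible radii is the
  greatest one.
\<close>

lemma admissible_radius_R_tilde:
  fixes f :: "real^'n \<Rightarrow> real^'n"
  assumes "open \<Omega>" and "0 \<in> \<Omega>" and "f differentiable (at 0)" and "f 0 = 0"
    and "matrix_spectral_radius (jacobian f (at 0)) < 1"
  shows "admissible_radius \<Omega> f (R_tilde \<Omega> f)"
proof -
  let ?A = "jacobian f (at 0)"
  have der: "(f has_derivative (*v) ?A) (at 0)"
    using assms(3) by (simp add: jacobian_works)
  have contr: "\<forall>\<^sub>F x in at 0. norm ((f ^^ p) x) < norm x" if "p \<ge> p_tilde f" for p
  proof (rule eventually_norm_less_if_onorm_less_1)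
    show "(f ^^ p has_derivative (*v) ?A ^^ p) (at 0)"
      using der assms(4) by (rule funpow_has_derivative_at_fixpoint)
    show "(f ^^ p) 0 = 0" using assms(4) by (induction p) auto
    have "(*v) ?A ^^ p = (*v) (matrix_power ?A p)"
      by (simp add: fun_eq_iff matrix_power_mult_vec)
    then show "onorm ((*v) ?A ^^ p) < 1"
      using p_tilde_works(2)[OF assms(5) that] by (simp add: matrix_opnorm_def)
  qed
  have "\<forall>\<^sub>F x in at 0. \<forall>p\<in>{p_tilde f .. 2 * p_tilde f - 1}. norm ((f ^^ p) x) < norm x"
    using contr by (intro eventually_ball_finite) auto
  then obtain d where "d > 0"
    and d: "\<And>x p. x \<noteq> 0 \<Longrightarrow> norm x < d \<Longrightarrow> p \<in> {p_tilde f .. 2 * p_tilde f - 1} \<Longrightarrow> norm ((f ^^ p) x) < norm x"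
    by (auto simp: eventually_at)
  obtain d' where "d' > 0" "ball 0 d' \<subseteq> \<Omega>" using assms(1,2) openE by blast
  then have adm: "admissible_radius \<Omega> f (ereal (min d d'))"
    using \<open>d > 0\<close> d by (auto simp: admissible_radius_def simp del: ereal_min)
  \<comment> \<open>The ball around \<open>0\<close> of radius \<open>?R\<close> is the union of the balls of admissible radius.\<close>
  let ?R = "Sup {r. admissible_radius \<Omega> f r}"
  have sub: "\<exists>r. admissible_radius \<Omega> f r \<and> x \<in> eball 0 r" if "x \<in> eball 0 ?R" for x
    using that by (auto simp: less_Sup_iff)
  have "0 < ereal (min d d')" using adm unfolding admissible_radius_def by blast
  also have "\<dots> \<le> ?R" using adm by (intro Sup_upper) simp
  finally have "0 < ?R" .
  moreover have "eball 0 ?R \<subseteq> \<Omega>"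
    using sub unfolding admissible_radius_def by blast
  moreover have "norm ((f ^^ p) x) < norm x"
    if "p \<in> {p_tilde f .. 2 * p_tilde f - 1}" "x \<in> eball 0 ?R - {0}" for p x
    using sub[of x] that unfolding admissible_radius_def by blast
  ultimately have "admissible_radius \<Omega> f ?R"
    unfolding admissible_radius_def by blast
  then show ?thesis
    unfolding R_tilde_def by (rule GreatestI2_order) (auto intro: Sup_upper)
qed

section \<open>Attraction\<close>

text \<open>
  No uniform contraction factor is available, so the limit \<open>L\<close> of the decreasing norms is identified
  at a cluster point \<open>y\<close> of the orbit: both \<open>y\<close> and \<open>g y\<close> have norm \<open>L\<close>, and strict decrease excludes
  \<open>y \<noteq> 0\<close>.
\<close>

lemma iterates_tendsto_0_if_norm_decreasing:
  fixes g :: "'a::euclidean_space \<Rightarrow> 'a"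
  assumes cont: "continuous_on (cball 0 r) g"
    and decr: "\<And>y. y \<in> cball 0 r \<Longrightarrow> y \<noteq> 0 \<Longrightarrow> norm (g y) < norm y"
    and "g 0 = 0" and x: "x \<in> cball 0 r"
  shows "(\<lambda>j. (g ^^ j) x) \<longlonglongrightarrow> 0"
proof -
  let ?u = "\<lambda>j. (g ^^ j) x"
  have step: "norm (g y) \<le> norm y" if "y \<in> cball 0 r" for y
    using decr[OF that] \<open>g 0 = 0\<close> by (cases "y = 0") auto
  have in_ball: "?u j \<in> cball 0 r" for j
    by (induction j) (use x step in \<open>auto intro: order_trans\<close>)
  have "decseq (\<lambda>j. norm (?u j))"
    using step in_ball by (auto intro!: decseq_SucI)
  then obtain L where L: "(\<lambda>j. norm (?u j)) \<longlonglongrightarrow> L"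
    using decseq_convergent[of _ 0] norm_ge_zero by metis
  obtain y s where y: "y \<in> cball 0 r" "strict_mono s" "(?u \<circ> s) \<longlonglongrightarrow> y"
    using compact_cball[of "0::'a" r] in_ball unfolding compact_def by meson
  have "(\<lambda>j. norm (?u (s j))) \<longlonglongrightarrow> L"
    using LIMSEQ_subseq_LIMSEQ[OF L y(2)] by (simp add: o_def)
  then have "norm y = L"
    using tendsto_norm[OF y(3)] by (auto intro: LIMSEQ_unique simp: o_def)
  have "(\<lambda>j. g (?u (s j))) \<longlonglongrightarrow> g y"
    using continuous_on_tendsto_compose[OF cont y(3) y(1)] in_ball by (simp add: o_def)
  moreover have "(\<lambda>j. norm (g (?u (s j)))) \<longlonglongrightarrow> L"
    using LIMSEQ_subseq_LIMSEQ[OF LIMSEQ_Suc[OF L] y(2)] by (simp add: o_def)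
  ultimately have "norm (g y) = L"
    using tendsto_norm LIMSEQ_unique by blast
  then have "L = 0" using decr[OF y(1)] \<open>norm y = L\<close> by force
  then show ?thesis using L by (simp add: tendsto_norm_zero_iff)
qed

text \<open>
  For each remainder \<open>i < p\<close> the subsequence of indices \<open>i + p * j\<close> is the image of a convergent
  sequence under \<open>f ^^ i\<close>; finitely many such subsequences exhaust the orbit.
\<close>

lemma iterates_tendsto_fixpoint_if_power_does:
  fixes f :: "'a::t2_space \<Rightarrow> 'a"
  assumes "p > 0" and "f a = a" and "isCont f a"
    and lim: "(\<lambda>j. ((f ^^ p) ^^ j) x) \<longlonglongrightarrow> a"
  shows "(\<lambda>k. (f ^^ k) x) \<longlonglongrightarrow> a"
proof (rule topological_tendstoI)
  fix S assume S: "open S" "a \<in> S"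
  have tail: "\<forall>\<^sub>F j in sequentially. (f ^^ (i + p * j)) x \<in> S" for i
  proof -
    have "(\<lambda>j. (f ^^ i) (((f ^^ p) ^^ j) x)) \<longlonglongrightarrow> a"
    proof (induction i)
      case (Suc i)
      then show ?case using isCont_tendsto_compose[OF assms(3) Suc] assms(2) by simp
    qed (use lim in simp)
    then show ?thesis using S by (simp add: topological_tendstoD funpow_add funpow_mult)
  qed
  have "\<forall>\<^sub>F j in sequentially. \<forall>i\<in>{..<p}. (f ^^ (i + p * j)) x \<in> S"
    using tail by (intro eventually_ball_finite) auto
  then obtain J where J: "\<And>j i. j \<ge> J \<Longrightarrow> i < p \<Longrightarrow> (f ^^ (i + p * j)) x \<in> S"
    by (auto simp: eventually_sequentially)
  have "(f ^^ k) x \<in> S" if "k \<ge> J * p" for k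
    using J[of "k div p" "k mod p"] that \<open>p > 0\<close> by (simp add: less_eq_div_iff_mult_less_eq)
  then show "\<forall>\<^sub>F k in sequentially. (f ^^ k) x \<in> S"
    unfolding eventually_sequentially by blast
qed

lemma continuous_on_funpow:
  assumes "continuous_on S f" and "f \<in> S \<rightarrow> S"
  shows "continuous_on S (f ^^ k)"
proof (induction k)
  case (Suc k)
  have "(f ^^ k) y \<in> S" if "y \<in> S" for y
    using assms(2) that by (induction k) auto
  then show ?case
    using continuous_on_compose[OF Suc continuous_on_subset[OF assms(1)]] by (auto simp: o_def)
qed simp

theorem theorem3p5:
  fixes \<Omega> :: "(real^'n) set" and f :: "real^'n \<Rightarrow> real^'n"
  assumes "open \<Omega>" and "connected \<Omega>" and "0 \<in> \<Omega>"
    and "f \<in> \<Omega> \<rightarrow> \<Omega>" and "real_analytic_on f \<Omega>" and "f 0 = 0"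
    and "matrix_spectral_radius (jacobian f (at 0)) < 1"
  shows "eball 0 (R_tilde \<Omega> f) \<subseteq> attraction_domain \<Omega> f"
proof
  fix x :: "real^'n" assume x: "x \<in> eball 0 (R_tilde \<Omega> f)"
  define p where "p = p_tilde f"
  have diff: "f differentiable (at y)" if "y \<in> \<Omega>" for y
    using real_analytic_on_imp_differentiable[OF assms(5) that] .
  have "p \<ge> 1" using p_tilde_works(1)[OF assms(7)] by (simp add: p_def)
  have "admissible_radius \<Omega> f (R_tilde \<Omega> f)"
    using assms(1,3) diff[OF assms(3)] assms(6,7) by (rule admissible_radius_R_tilde)
  then have sub: "eball 0 (R_tilde \<Omega> f) \<subseteq> \<Omega>"
    and decr: "\<And>y. y \<in> eball 0 (R_tilde \<Omega> f) - {0} \<Longrightarrow> norm ((f ^^ p) y) < norm y"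
    using \<open>p \<ge> 1\<close> by (auto simp: admissible_radius_def p_def)
  have cball: "cball (0 :: real^'n) (norm x) \<subseteq> eball 0 (R_tilde \<Omega> f)"
  proof
    fix y :: "real^'n" assume "y \<in> cball 0 (norm x)"
    then have "ereal (dist 0 y) \<le> ereal (dist 0 x)" by simp
    then show "y \<in> eball 0 (R_tilde \<Omega> f)"
      using x unfolding in_eball_iff by (rule le_less_trans)
  qed
  have isCont: "isCont f y" if "y \<in> \<Omega>" for y
    using diff[OF that] by (rule differentiable_imp_continuous_within)
  have "continuous_on \<Omega> (f ^^ p)"
    using isCont assms(4) by (intro continuous_on_funpow continuous_at_imp_continuous_on) auto
  then have "continuous_on (cball 0 (norm x)) (f ^^ p)"
    using cball sub continuous_on_subset by (metis order_trans)
  moreover have "(f ^^ p) 0 = 0" using assms(6) by (induction p) auto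
  ultimately have "(\<lambda>j. ((f ^^ p) ^^ j) x) \<longlonglongrightarrow> 0"
    using cball decr by (intro iterates_tendsto_0_if_norm_decreasing[of "norm x"]) (blast | simp)+
  then have "(\<lambda>k. (f ^^ k) x) \<longlonglongrightarrow> 0"
    using \<open>p \<ge> 1\<close> assms(6) isCont[OF assms(3)]
    by (intro iterates_tendsto_fixpoint_if_power_does[of p f]) simp_all
  then show "x \<in> attraction_domain \<Omega> f"
    using x sub by (auto simp: attraction_domain_def)
qed

end
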